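(* Let $d\in\{2,3\}$, $\mathcal{M}\subset\mathbb{R}^d$, and let $w_1,\dots,w_n$ be the softmax weights of a fixed directional basis $\mathcal{D}\subset\mathbb{S}^{d-1}$ and temperature $\varepsilon>0$. Suppose the environment signals $f_{\mathbf{p}}:\mathbb{S}^{d-1}\to\mathbb{R}$, $\mathbf{p}\in\mathcal{M}$, satisfy: (L1) $f_{\mathbf{p}}(\boldsymbol\theta)\ge0$ for all $\mathbf{p}\in\mathcal{M}$ and $\sigma$-almost every $\boldsymbol\theta$; (L2) for $\sigma$-almost every $\boldsymbol\theta$, the map $\mathbf{p}\mapsto f_{\mathbf{p}}(\boldsymbol\theta)$ is lower semicontinuous on $\mathcal{M}$, i.e. $\liminf_{\mathbf{p}'\to\mathbf{p}}f_{\mathbf{p}'}(\boldsymbol\theta)\ge f_{\mathbf{p}}(\boldsymbol\theta)$; (L3) there exists $g\in L^1(\mathbb{S}^{d-1})$ such that $f_{\mathbf{p}}(\boldsymbol\theta)\le g(\boldsymbol\theta)$ for all $\mathbf{p}\in\mathcal{M}$ and $\sigma$-almost every $\boldsymbol\theta$. Then for every $i=1,\dots,n$, the feature component $\mathbf{p}\mapsto\phi_i(\mathbf{p})=\int_{\mathbb{S}^{d-1}}f_{\mathbf{p}}w_i\,\mathrm{d}\sigma$ is lower semicontinuous on $\mathcal{M}$.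
   Context: $\mathbb{S}^{d-1}$ is the unit sphere of $\mathbb{R}^d$ with standard surface measure $\sigma$. The softmax weights of a directional basis (finite set of unit vectors) $\{\mathbf{d}_1,\dots,\mathbf{d}_n\}$ and temperature $\varepsilon>0$ are $$w_i(\boldsymbol\theta)=\frac{\exp(\boldsymbol\theta^{\top}\mathbf{d}_i/\varepsilon)}{\sum_{j=1}^n\exp(\boldsymbol\theta^{\top}\mathbf{d}_j/\varepsilon)}.$$ Each $f_{\mathbf{p}}$ is a measurable function on $\mathbb{S}^{d-1}$. *)

theory Defs
  imports "HOL-Analysis.Analysis"
begin

(*
  Surface measure on the unit sphere, with all Lebesgue measurable subsets of the sphere as
  measurable sets (hence the completion).  On Borel sets it is given by polar coordinates:
    sigma A = d * Leb {x. 0 < |x| <= 1 and x / |x| in A},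
  the factor d coming from  integral of r^(d-1) over 0 < r <= 1  =  1 / d.
  The library has no surface or Hausdorff measure.  The measure is not normalised: see
  emeasure_sphere_measure and emeasure_sphere_measure_2_3 for the total mass.
*)
definition sphere_borel_measure :: "'a::euclidean_space measure" where
  "sphere_borel_measure =
     scale_measure (of_nat DIM('a))
       (distr (restrict_space lborel (cball 0 1 - {0}))
              (restrict_space borel (sphere 0 1))
              (\<lambda>x. x /\<^sub>R norm x))"

definition sphere_measure :: "'a::euclidean_space measure" where
  "sphere_measure = completion sphere_borel_measure"

lemma space_sphere_measure [simp]: "space sphere_measure = sphere 0 1"
  by (simp add: sphere_measure_def sphere_borel_measure_def space_scale_measure space_restrict_space)

lemma radial_projection_measurable:
  "(\<lambda>x::'a::euclidean_space. x /\<^sub>R norm x)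
     \<in> restrict_space lborel (cball 0 1 - {0}) \<rightarrow>\<^sub>M restrict_space borel (sphere 0 1)"
  by (intro measurable_restrict_space2 measurable_restrict_space1)
     (auto simp: space_restrict_space)

lemma emeasure_sphere_borel_measure:
  fixes A :: "'a::euclidean_space set"
  assumes "A \<in> sets (restrict_space borel (sphere 0 1))"
  shows "emeasure sphere_borel_measure A =
           of_nat DIM('a) * emeasure lborel {x. 0 < norm x \<and> norm x \<le> 1 \<and> x /\<^sub>R norm x \<in> A}"
proof -
  have eq: "(\<lambda>x. x /\<^sub>R norm x) -` A \<inter> space (restrict_space lborel (cball 0 1 - {0}))
      = {x. 0 < norm x \<and> norm x \<le> 1 \<and> x /\<^sub>R norm x \<in> A}"
    by (auto simp: space_restrict_space)
  have "emeasure (distr (restrict_space lborel (cball 0 1 - {0})) (restrict_space borel (sphere 0 1))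
              (\<lambda>x. x /\<^sub>R norm x)) A
        = emeasure lborel {x. 0 < norm x \<and> norm x \<le> 1 \<and> x /\<^sub>R norm x \<in> A}"
    unfolding emeasure_distr[OF radial_projection_measurable assms] eq
    by (rule emeasure_restrict_space) auto
  then show ?thesis
    by (simp add: sphere_borel_measure_def)
qed

lemma emeasure_sphere_measure:
  "emeasure sphere_measure (sphere 0 1 :: 'a::euclidean_space set)
     = ennreal (DIM('a) * unit_ball_vol DIM('a))"
proof -
  have s: "sphere (0::'a) 1 \<in> sets (restrict_space borel (sphere 0 1))"
    by (auto simp: sets_restrict_space)
  then have s': "sphere (0::'a) 1 \<in> sets sphere_borel_measure"
    by (simp add: sphere_borel_measure_def)
  have eq: "{x::'a. 0 < norm x \<and> norm x \<le> 1 \<and> x /\<^sub>R norm x \<in> sphere 0 1} = cball 0 1 - {0}"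
    by auto
  have "emeasure lborel (cball (0::'a) 1 - {0}) = emeasure lborel (cball (0::'a) 1)"
    by (subst emeasure_Diff) auto
  also have "\<dots> = ennreal (unit_ball_vol DIM('a))"
    by (simp add: emeasure_cball)
  finally have ball: "emeasure lborel (cball (0::'a) 1 - {0}) = ennreal (unit_ball_vol DIM('a))" .
  have "emeasure sphere_measure (sphere (0::'a) 1) = emeasure sphere_borel_measure (sphere (0::'a) 1)"
    unfolding sphere_measure_def using s' by simp
  also have "\<dots> = ennreal (DIM('a) * unit_ball_vol DIM('a))"
    unfolding emeasure_sphere_borel_measure[OF s] eq ball
    by (simp add: ennreal_mult ennreal_of_nat_eq_real_of_nat)
  finally show ?thesis .
qed

lemma emeasure_sphere_measure_2_3:
  "DIM('a::euclidean_space) = 2 \<Longrightarrow> emeasure sphere_measure (sphere 0 1 :: 'a set) = ennreal (2 * pi)"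
  "DIM('a::euclidean_space) = 3 \<Longrightarrow> emeasure sphere_measure (sphere 0 1 :: 'a set) = ennreal (4 * pi)"
  by (simp_all add: emeasure_sphere_measure eval_unit_ball_vol)

definition softmax_weight ::
    "nat \<Rightarrow> (nat \<Rightarrow> 'a::euclidean_space) \<Rightarrow> real \<Rightarrow> nat \<Rightarrow> 'a \<Rightarrow> real" where
  "softmax_weight n b \<epsilon> i \<theta> =
     exp ((\<theta> \<bullet> b i) / \<epsilon>) / (\<Sum>j\<in>{1..n}. exp ((\<theta> \<bullet> b j) / \<epsilon>))"

(*
  The limit inferior is taken in the extended reals, as it may be infinite.  At an isolated point
  of M the filter is trivial and Liminf is plus infinity, so the condition holds there.
*)
definition lsc_on :: "'a::topological_space set \<Rightarrow> ('a \<Rightarrow> real) \<Rightarrow> bool" where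
  "lsc_on M h \<longleftrightarrow>
     (\<forall>p\<in>M. ereal (h p) \<le> Liminf (at p within M) (\<lambda>p'. ereal (h p')))"

end

theory Submission
  imports Defs
begin

text \<open>
  Lower semicontinuity within a subset of a first countable space is tested along sequences, and
  along a fixed sequence only countably many of the exceptional null sets in the hypotheses occur,
  so Fatou's lemma applies. The softmax weights are positive, at most 1 and continuous, so the
  products of the signals with a weight inherit all the hypotheses, with the same bound g.
\<close>

text \<open>Replaces the extended-real limit inferior by real thresholds that hold eventually, a
  form that composes directly with a sequence tending to \<open>p\<close>. Isolated points need no
  case of their own, since everything holds eventually in the trivial filter.\<close>

lemma lsc_on_iff_eventually:
  "lsc_on M h \<longleftrightarrow> (\<forall>p\<in>M. \<forall>y<h p. eventually (\<lambda>q. y < h q) (at p within M))"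
proof -
  have "ereal (h p) \<le> Liminf (at p within M) (\<lambda>q. ereal (h q)) \<longleftrightarrow>
      (\<forall>y<h p. eventually (\<lambda>q. y < h q) (at p within M))" for p
  proof
    assume *: "ereal (h p) \<le> Liminf (at p within M) (\<lambda>q. ereal (h q))"
    show "\<forall>y<h p. eventually (\<lambda>q. y < h q) (at p within M)"
    proof (intro allI impI)
      fix y assume "y < h p"
      then have "eventually (\<lambda>q. ereal y < ereal (h q)) (at p within M)"
        using * unfolding le_Liminf_iff by (metis less_ereal.simps(1))
      then show "eventually (\<lambda>q. y < h q) (at p within M)" by simp
    qed
  next
    assume *: "\<forall>y<h p. eventually (\<lambda>q. y < h q) (at p within M)"
    show "ereal (h p) \<le> Liminf (at p within M) (\<lambda>q. ereal (h q))"
      unfolding le_Liminf_iff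
    proof (intro allI impI)
      fix y assume "y < ereal (h p)"
      \<comment> \<open>Below \<open>ereal (h p)\<close> the threshold is either real, where the
        assumption applies, or minus infinity, which lies below every real value.\<close>
      then show "eventually (\<lambda>q. y < ereal (h q)) (at p within M)"
        using * by (cases y) auto
    qed
  qed
  then show ?thesis by (simp add: lsc_on_def)
qed

lemma lsc_on_mult_right:
  assumes "lsc_on M h" "0 < c"
  shows "lsc_on M (\<lambda>p. h p * c)"
  unfolding lsc_on_iff_eventually
proof (intro ballI allI impI)
  fix p y assume "p \<in> M" "y < h p * c"
  then have "y / c < h p"
    using assms(2) by (simp add: pos_divide_less_eq)
  then have "eventually (\<lambda>q. y / c < h q) (at p within M)"
    using assms(1) \<open>p \<in> M\<close> by (simp add: lsc_on_iff_eventually)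
  then show "eventually (\<lambda>q. y < h q * c) (at p within M)"
    using assms by (simp add: pos_divide_less_eq)
qed

text \<open>Brings pointwise lower semicontinuity into the form required by Fatou's lemma. Although
  \<open>ennreal\<close> sends negative reals to 0, nothing is lost: a threshold strictly below
  \<open>ennreal x\<close> is itself a real \<open>r\<close> with 0 \<le> r < x.\<close>

lemma ennreal_le_liminf:
  fixes x :: real
  assumes "\<And>y. y < x \<Longrightarrow> eventually (\<lambda>k. y < u k) sequentially"
  shows "ennreal x \<le> liminf (\<lambda>k. ennreal (u k))"
  unfolding le_Liminf_iff
proof (intro allI impI)
  fix y assume y: "y < ennreal x"
  then obtain r where r: "y = ennreal r" "0 \<le> r"
    by (cases y) auto
  then have "eventually (\<lambda>k. r < u k) sequentially"
    using y by (intro assms) (simp add: ennreal_less_iff)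
  then show "eventually (\<lambda>k. y < ennreal (u k)) sequentially"
    using r by (simp add: ennreal_less_iff)
qed

lemma lsc_on_integral:
  fixes F :: "'a::first_countable_topology \<Rightarrow> 'b \<Rightarrow> real"
  assumes meas: "\<And>p. p \<in> M \<Longrightarrow> F p \<in> borel_measurable N"
    and nonneg: "\<And>p. p \<in> M \<Longrightarrow> AE x in N. 0 \<le> F p x"
    and lsc: "AE x in N. lsc_on M (\<lambda>p. F p x)"
    and g: "integrable N g"
    and bound: "\<And>p. p \<in> M \<Longrightarrow> AE x in N. F p x \<le> g x"
  shows "lsc_on M (\<lambda>p. LINT x|N. F p x)"
  unfolding lsc_on_iff_eventually
proof (intro ballI allI impI)
  fix p y assume p: "p \<in> M" and y: "y < (LINT x|N. F p x)"
  \<comment> \<open>The bound \<open>g\<close> enters only here. It makes each \<open>F q\<close>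
    integrable, so its Bochner integral is the true value rather than the default 0, and Fatou's
    inequality for \<open>nn_integral\<close> says something about it.\<close>
  have nn: "(\<integral>\<^sup>+x. ennreal (F q x) \<partial>N) = ennreal (LINT x|N. F q x)" if "q \<in> M" for q
  proof (rule nn_integral_eq_integral)
    have "AE x in N. norm (F q x) \<le> norm (g x)"
      using nonneg[OF that] bound[OF that] by eventually_elim auto
    then show "integrable N (F q)"
      using g meas[OF that] by (rule Bochner_Integration.integrable_bound[rotated 2])
  qed (rule nonneg[OF that])
  show "eventually (\<lambda>q. y < (LINT x|N. F q x)) (at p within M)"
  proof (rule sequentially_imp_eventually_within, intro allI impI, elim conjE)
    fix s assume s: "\<forall>k. s k \<in> M \<and> s k \<noteq> p" "s \<longlonglongrightarrow> p"
    then have sM: "s k \<in> M" for k by simp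
    have lim: "filterlim s (at p within M) sequentially"
      using s by (auto simp: filterlim_at)
    show "eventually (\<lambda>k. y < (LINT x|N. F (s k) x)) sequentially"
    \<comment> \<open>A negative \<open>y\<close> would become 0 under \<open>ennreal\<close>, and
      the strict comparison would be lost; nonnegativity of the integrals settles that case
      directly.\<close>
    proof (cases "y < 0")
      case True
      have "y < (LINT x|N. F (s k) x)" for k
        using integral_nonneg_AE[OF nonneg[OF sM]] True by (meson less_le_trans)
      then show ?thesis by simp
    next
      case False
      \<comment> \<open>Outside the single null set of \<open>lsc\<close>, the section at
        \<open>x\<close> is lower semicontinuous at \<open>p\<close>; composing its thresholds with
        \<open>lim\<close> gives the bound along \<open>s\<close>.\<close>
      have "AE x in N. ennreal (F p x) \<le> liminf (\<lambda>k. ennreal (F (s k) x))"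
        using lsc
      proof eventually_elim
        case (elim x)
        show ?case
          using elim p lim
          by (intro ennreal_le_liminf) (auto simp: lsc_on_iff_eventually filterlim_iff)
      qed
      then have "(\<integral>\<^sup>+x. ennreal (F p x) \<partial>N) \<le> (\<integral>\<^sup>+x. liminf (\<lambda>k. ennreal (F (s k) x)) \<partial>N)"
        by (rule nn_integral_mono_AE)
      also have "\<dots> \<le> liminf (\<lambda>k. \<integral>\<^sup>+x. ennreal (F (s k) x) \<partial>N)"
        using meas[OF sM] by (intro nn_integral_liminf) simp
      finally have "ennreal (LINT x|N. F p x) \<le> liminf (\<lambda>k. ennreal (LINT x|N. F (s k) x))"
        by (simp add: nn p sM)
      moreover have "ennreal y < ennreal (LINT x|N. F p x)"
        using y False by (simp add: ennreal_less_iff)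
      ultimately have "eventually (\<lambda>k. ennreal y < ennreal (LINT x|N. F (s k) x)) sequentially"
        unfolding le_Liminf_iff by blast
      then show ?thesis
        using False by (simp add: ennreal_less_iff)
    qed
  qed
qed

text \<open>Scaling and \<open>distr\<close> keep the Borel sets of the sphere as the sigma-algebra,
  and completion only enlarges it.\<close>

lemma borel_measurable_sphere_measure:
  fixes h :: "'a::euclidean_space \<Rightarrow> 'b::topological_space"
  assumes "h \<in> borel_measurable borel"
  shows "h \<in> borel_measurable sphere_measure"
proof -
  have "h \<in> borel_measurable (restrict_space borel (sphere 0 1))"
    using assms by (rule measurable_restrict_space1)
  also have "borel_measurable (restrict_space borel (sphere (0::'a) 1)) =
      (borel_measurable sphere_borel_measure :: ('a \<Rightarrow> 'b) set)"
    by (rule measurable_cong_sets) (simp_all add: sphere_borel_measure_def)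
  finally show ?thesis
    unfolding sphere_measure_def by (rule measurable_completion)
qed

lemma softmax_weight_pos:
  assumes "i \<in> {1..n}"
  shows "0 < softmax_weight n b \<epsilon> i \<theta>"
  unfolding softmax_weight_def
  using assms by (intro divide_pos_pos sum_pos) auto

lemma softmax_weight_le_1:
  assumes "i \<in> {1..n}"
  shows "softmax_weight n b \<epsilon> i \<theta> \<le> 1"
proof -
  let ?S = "\<Sum>j\<in>{1..n}. exp ((\<theta> \<bullet> b j) / \<epsilon>)"
  have "0 < ?S"
    using assms by (intro sum_pos) auto
  moreover have "exp ((\<theta> \<bullet> b i) / \<epsilon>) \<le> ?S"
    using assms by (intro member_le_sum) auto
  ultimately show ?thesis
    by (simp add: softmax_weight_def)
qed

lemma borel_measurable_softmax_weight: "softmax_weight n b \<epsilon> i \<in> borel_measurable borel"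
  unfolding softmax_weight_def[abs_def] by measurable

theorem proposition16:
  fixes \<M> \<D> :: "(real ^ 'd) set"
    and b :: "nat \<Rightarrow> real ^ 'd"
    and n :: nat
    and \<epsilon> :: real
    and f :: "real ^ 'd \<Rightarrow> real ^ 'd \<Rightarrow> real"
  assumes "CARD('d) \<in> {2, 3}"
    and "\<D> \<subseteq> sphere 0 1"
    and "bij_betw b {1..n} \<D>"
    and "\<epsilon> > 0"
    and "\<forall>p\<in>\<M>. f p \<in> borel_measurable sphere_measure"
    and L1: "\<forall>p\<in>\<M>. AE \<theta> in sphere_measure. 0 \<le> f p \<theta>"
    and L2: "AE \<theta> in sphere_measure. lsc_on \<M> (\<lambda>p. f p \<theta>)"
    and L3: "\<exists>g. integrable sphere_measure g \<and>
                 (\<forall>p\<in>\<M>. AE \<theta> in sphere_measure. f p \<theta> \<le> (g \<theta> :: real))"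
  shows "\<forall>i\<in>{1..n}. lsc_on \<M>
           (\<lambda>p. LINT \<theta>|sphere_measure. f p \<theta> * softmax_weight n b \<epsilon> i \<theta>)"
proof
  fix i assume i: "i \<in> {1..n}"
  let ?w = "softmax_weight n b \<epsilon> i"
  obtain g where g: "integrable sphere_measure g"
    and fg: "\<And>p. p \<in> \<M> \<Longrightarrow> AE \<theta> in sphere_measure. f p \<theta> \<le> g \<theta>"
    using L3 by blast
  show "lsc_on \<M> (\<lambda>p. LINT \<theta>|sphere_measure. f p \<theta> * ?w \<theta>)"
  proof (rule lsc_on_integral[OF _ _ _ g])
    fix p assume p: "p \<in> \<M>"
    show "(\<lambda>\<theta>. f p \<theta> * ?w \<theta>) \<in> borel_measurable sphere_measure"
      using assms(5) p
      by (auto intro: borel_measurable_times borel_measurable_sphere_measure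
          borel_measurable_softmax_weight)
    have f0: "AE \<theta> in sphere_measure. 0 \<le> f p \<theta>"
      using L1 p by blast
    then show "AE \<theta> in sphere_measure. 0 \<le> f p \<theta> * ?w \<theta>"
      by eventually_elim (simp add: softmax_weight_pos[OF i] less_imp_le)
    show "AE \<theta> in sphere_measure. f p \<theta> * ?w \<theta> \<le> g \<theta>"
      using f0 fg[OF p]
    proof eventually_elim
      case (elim \<theta>)
      \<comment> \<open>Shrinking by a factor at most 1 decreases the value because
        \<open>f p \<theta>\<close> is nonnegative; so \<open>g\<close> still dominates.\<close>
      then have "f p \<theta> * ?w \<theta> \<le> f p \<theta>"
        by (intro mult_left_le softmax_weight_le_1[OF i])
      with elim show ?case by simp
    qed
  next
    \<comment> \<open>With \<theta> fixed, the weight is a positive constant in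
      \<open>p\<close>.\<close>
    show "AE \<theta> in sphere_measure. lsc_on \<M> (\<lambda>p. f p \<theta> * ?w \<theta>)"
      using L2 by eventually_elim (rule lsc_on_mult_right[OF _ softmax_weight_pos[OF i]])
  qed
qed

end
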